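(* Let $\chi=\chi_{l(0,0,1,1,0,0)}$ on $S_{(\mathrm{II})}$. Then $$C^{\infty}_{\chi}(S_{(\mathrm{II})}\backslash N\times A;I_{k}(\lambda))=\{0\}$$ for $k=1,2$.
   Context: $G=GL(4,\mathbb{R})$, $K=O(4)$, $A$ is the group of diagonal matrices $\mathrm{diag}(a_1,\dots,a_4)$ with $a_i>0$, $N$ is the group of lower triangular matrices with $1$s on the diagonal, $\mathfrak{n}=\mathrm{Lie}(N)$, $E_{ij}$ are the matrix units. $U(\mathfrak{g})$, the universal enveloping algebra of $\mathfrak{gl}(4,\mathbb{C})$, acts on $C^{\infty}(G)$ by extending $R_{X}f(g)=\frac{d}{dt}f(g\exp tX)|_{t=0}$. $(\lambda_{1},\lambda_{2})\in\mathbb{C}^{2}$ with $\lambda_{1}-\lambda_{2}\notin\mathbb{Z}$. With $\mathbb{E}=(E_{ij})\in M(4;U(\mathfrak{g}))$ and $k\in\{1,2\}$, $I_{k}(\lambda)$ is the left ideal $\sum_{i,j=1}^{4}U(\mathfrak{g})\big((\mathbb{E}-\lambda_{1})(\mathbb{E}-\lambda_{2}-k)\big)_{ij}+U(\mathfrak{g})\big(\sum_{i=1}^{4}E_{ii}-k\lambda_{1}-(4-k)\lambda_{2}\big)$. $l(\alpha,\beta_1,\beta_2,\gamma_1,\gamma_2,\gamma_3)\in\mathfrak{n}^{*}$ is the linear form sending the strictly lower triangular matrix with entries $x_1,x_2,x_3$ at $(2,1),(3,2),(4,3)$, $y_1,y_2$ at $(3,1),(4,2)$ and $z$ at $(4,1)$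 to $\alpha z+\beta_1y_1+\beta_2y_2+\gamma_1x_1+\gamma_2x_2+\gamma_3x_3$; and $\chi_{l}(\exp X)=e^{2\pi\sqrt{-1}\,l(X)}$. $S_{(\mathrm{II})}=\exp(\mathbb{R}E_{21}+\mathbb{R}E_{43}+\mathbb{R}E_{31}+\mathbb{R}E_{42}+\mathbb{R}E_{41})$. $C^{\infty}_{\chi}(S_{(\mathrm{II})}\backslash G/K;I_{k}(\lambda))=\{f\in C^{\infty}(G)\mid f(sgk')=\chi(s)f(g)\ (s\in S_{(\mathrm{II})},k'\in K),\ R_{X}f=0\ (X\in I_{k}(\lambda))\}$. $S_{(\mathrm{II})}\backslash N\times A$ has coordinates $(u;a_1,\dots,a_4)\in\mathbb{R}\times(\mathbb{R}_{>0})^{4}$ and $\Xi_{(\mathrm{II})}(f)(u;a)=f(\exp(uE_{32})a)$. $C^{\infty}_{\chi}(S_{(\mathrm{II})}\backslash N\times A;I_{k}(\lambda))$ is the image of $C^{\infty}_{\chi}(S_{(\mathrm{II})}\backslash G/K;I_{k}(\lambda))$ under $\Xi_{(\mathrm{II})}$. *)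

theory Defs
  imports "HOL-Analysis.Analysis" "HOL-Library.Poly_Mapping"
begin

section \<open>The matrix exponential\<close>

text \<open>The library's \<^term>\<open>exp\<close> does not apply to matrices, because the multiplication
  \<^term>\<open>(*)\<close> of the type constructor for vectors is entrywise.\<close>

definition mexp :: "real^'n^'n \<Rightarrow> real^'n^'n" where
  "mexp X = suminf (\<lambda>n. ((((**) X) ^^ n) (mat 1)) /\<^sub>R fact n)"

lemma bounded_linear_matrix_mult_left: "bounded_linear (\<lambda>Y::real^'n^'n. X ** Y)"
  by (intro linear_conv_bounded_linear[THEN iffD1] linearI)
     (simp_all add: vec_eq_iff matrix_matrix_mult_def sum_distrib_left sum.distrib algebra_simps)

lemma matpow_scaleR:
  "(((**) (t *\<^sub>R X)) ^^ n) (mat 1) = t ^ n *\<^sub>R (((**) (X::real^'n^'n)) ^^ n) (mat 1)"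
proof (induction n)
  case (Suc n)
  then show ?case
    by (simp add: vec_eq_iff matrix_matrix_mult_def sum_distrib_left mult_ac)
qed simp

lemma summable_mexp:
  fixes X :: "real^'n^'n"
  shows "summable (\<lambda>n. norm (((((**) X) ^^ n) (mat 1)) /\<^sub>R fact n))"
proof -
  obtain C where C: "C > 0" "\<And>Y::real^'n^'n. norm (X ** Y) \<le> norm Y * C"
    using bounded_linear.pos_bounded[OF bounded_linear_matrix_mult_left[of X]] by blast
  have b: "norm ((((**) X) ^^ n) (mat 1 :: real^'n^'n)) \<le> norm (mat 1 :: real^'n^'n) * C ^ n" for n
  proof (induction n)
    case (Suc n)
    have "norm ((((**) X) ^^ Suc n) (mat 1 :: real^'n^'n)) \<le> norm ((((**) X) ^^ n) (mat 1 :: real^'n^'n)) * C"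
      using C(2)[of "(((**) X) ^^ n) (mat 1)"] by (simp only: funpow.simps o_apply)
    also have "\<dots> \<le> (norm (mat 1 :: real^'n^'n) * C ^ n) * C"
      using Suc C(1) by (intro mult_right_mono) auto
    finally show ?case by (simp add: mult_ac)
  qed simp
  have "summable (\<lambda>n. norm (mat 1 :: real^'n^'n) * (inverse (fact n) * C ^ n))"
    by (intro summable_mult summable_exp)
  then show ?thesis
    by (rule summable_comparison_test[rotated])
       (use b in \<open>auto intro!: exI[of _ 0] mult_left_mono simp: mult.left_commute\<close>)
qed

lemma mexp_nth:
  "mexp (t *\<^sub>R X) $ i $ j = suminf (\<lambda>n. ((((**) X) ^^ n) (mat 1) $ i $ j / fact n) * t ^ n)"
  and summable_mexp_nth: "summable (\<lambda>n. ((((**) (X::real^'n^'n)) ^^ n) (mat 1) $ i $ j / fact n) * t ^ n)"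
proof -
  have s: "summable (\<lambda>n. ((((**) (t *\<^sub>R X)) ^^ n) (mat 1)) /\<^sub>R fact n)"
    by (rule summable_norm_cancel[OF summable_mexp])
  have bl: "bounded_linear (\<lambda>Y::real^'n^'n. Y $ i $ j)"
    by (intro bounded_linear_compose[OF bounded_linear_vec_nth bounded_linear_vec_nth])
  have "summable (\<lambda>n. (((((**) (t *\<^sub>R X)) ^^ n) (mat 1)) /\<^sub>R fact n) $ i $ j)"
    by (rule bounded_linear.summable[OF bl s])
  then show "summable (\<lambda>n. ((((**) X) ^^ n) (mat 1) $ i $ j / fact n) * t ^ n)"
    by (simp add: matpow_scaleR field_simps)
  show "mexp (t *\<^sub>R X) $ i $ j = suminf (\<lambda>n. ((((**) X) ^^ n) (mat 1) $ i $ j / fact n) * t ^ n)"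
    unfolding mexp_def bounded_linear.suminf[OF bl s]
    by (simp add: matpow_scaleR field_simps)
qed

lemma mexp_0 [simp]: "mexp (0 :: real^'n^'n) = mat 1"
proof -
  have "mexp (0 *\<^sub>R 0) $ i $ j = (mat 1 :: real^'n^'n) $ i $ j" for i j
    unfolding mexp_nth powser_zero by simp
  then show ?thesis by (simp add: vec_eq_iff)
qed

lemma mexp_has_vector_derivative:
  fixes X :: "real^'n^'n"
  shows "((\<lambda>t. mexp (t *\<^sub>R X)) has_vector_derivative X) (at 0)"
proof -
  have "((\<lambda>t. mexp (t *\<^sub>R X) $ i $ j) has_real_derivative X $ i $ j) (at 0)" for i j
  proof -
    let ?c = "\<lambda>n. (((**) X) ^^ n) (mat 1) $ i $ j / fact n"
    have "((\<lambda>t. suminf (\<lambda>n. ?c n * t ^ n)) has_real_derivative (suminf (\<lambda>n. diffs ?c n * 0 ^ n))) (at 0)"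
      by (rule termdiffs_strong_converges_everywhere) (rule summable_mexp_nth)
    also have "suminf (\<lambda>n. diffs ?c n * 0 ^ n) = X $ i $ j"
      unfolding powser_zero by (simp add: diffs_def)
    finally show ?thesis by (simp add: mexp_nth)
  qed
  then have "((\<lambda>t. mexp (t *\<^sub>R X) $ i $ j) has_derivative (\<lambda>t. t * X $ i $ j)) (at 0)" for i j
    unfolding has_field_derivative_def by (simp add: mult.commute[of _ "X $ i $ j"])
  then have "((\<lambda>t. mexp (t *\<^sub>R X)) has_derivative (\<lambda>t. t *\<^sub>R X)) (at 0)"
    by (subst has_derivative_componentwise_within) (auto simp: Basis_vec_def inner_axis)
  then show ?thesis by (simp add: has_vector_derivative_def)
qed

section \<open>Smooth functions on open sets\<close>

fun C_k_on :: "nat \<Rightarrow> ('a::real_normed_vector \<Rightarrow> 'b::real_normed_vector) \<Rightarrow> 'a set \<Rightarrow> bool" where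
  "C_k_on 0 f S \<longleftrightarrow> continuous_on S f"
| "C_k_on (Suc k) f S \<longleftrightarrow> (\<forall>x\<in>S. f differentiable (at x)) \<and>
     (\<forall>v. C_k_on k (\<lambda>x. frechet_derivative f (at x) v) S)"

definition smooth_on :: "'a set \<Rightarrow> ('a::real_normed_vector \<Rightarrow> 'b::real_normed_vector) \<Rightarrow> bool" where
  "smooth_on S f \<longleftrightarrow> (\<forall>k. C_k_on k f S)"

lemma frechet_cong:
  assumes "open S" "x \<in> S" "\<And>y. y \<in> S \<Longrightarrow> f y = g y"
  shows "frechet_derivative f (at x) = frechet_derivative g (at x)"
proof -
  have "(f has_derivative D) (at x) \<longleftrightarrow> (g has_derivative D) (at x)" for D
    using assms by (metis has_derivative_transform_within_open)
  then show ?thesis by (simp add: frechet_derivative_def)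
qed

lemma C_k_on_cong:
  assumes "open S" "\<And>y. y \<in> S \<Longrightarrow> f y = g y"
  shows "C_k_on k f S \<longleftrightarrow> C_k_on k g S"
  using assms(2)
proof (induction k arbitrary: f g)
  case 0
  then show ?case by (simp cong: continuous_on_cong)
next
  case (Suc k)
  have "f differentiable (at x) \<longleftrightarrow> g differentiable (at x)" if "x \<in> S" for x
    unfolding differentiable_def using that assms(1) Suc.prems
    by (metis has_derivative_transform_within_open)
  moreover have "C_k_on k (\<lambda>x. frechet_derivative f (at x) v) S \<longleftrightarrow> C_k_on k (\<lambda>x. frechet_derivative g (at x) v) S" for v
    by (rule Suc.IH) (use frechet_cong[OF assms(1) _ Suc.prems] in auto)
  ultimately show ?case by auto
qed

lemma smooth_on_cong:
  assumes "open S" "\<And>y. y \<in> S \<Longrightarrow> f y = g y"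
  shows "smooth_on S f \<longleftrightarrow> smooth_on S g"
  using C_k_on_cong[OF assms] by (simp add: smooth_on_def)

lemma C_k_on_Suc_imp: "C_k_on (Suc k) f S \<Longrightarrow> C_k_on k f S"
proof (induction k arbitrary: f)
  case 0
  then show ?case
    by (auto intro!: continuous_at_imp_continuous_on differentiable_imp_continuous_within)
next
  case (Suc k)
  then show ?case by (metis C_k_on.simps(2))
qed

lemma frechet_eqI: "(f has_derivative D) (at x) \<Longrightarrow> frechet_derivative f (at x) = D"
  using frechet_derivative_at by metis

lemma differentiable_has: "f differentiable (at x) \<Longrightarrow> (f has_derivative frechet_derivative f (at x)) (at x)"
  using frechet_derivative_works by blast

lemma C_k_on_add:
  "open S \<Longrightarrow> C_k_on k f S \<Longrightarrow> C_k_on k g S \<Longrightarrow> C_k_on k (\<lambda>x. f x + g x) S"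
proof (induction k arbitrary: f g)
  case 0
  then show ?case by (auto intro: continuous_intros)
next
  case (Suc k)
  have d: "frechet_derivative (\<lambda>x. f x + g x) (at x) v =
      frechet_derivative f (at x) v + frechet_derivative g (at x) v" if "x \<in> S" for x v
    using that Suc.prems by (subst frechet_eqI[OF has_derivative_add[OF differentiable_has differentiable_has]]) auto
  have "C_k_on k (\<lambda>x. frechet_derivative (\<lambda>x. f x + g x) (at x) v) S" for v
    by (rule iffD2[OF C_k_on_cong[OF Suc.prems(1)]], erule d) (use Suc in \<open>auto intro!: Suc.IH\<close>)
  then show ?case using Suc.prems by (auto intro: differentiable_add)
qed

lemma C_k_on_linear:
  assumes "bounded_linear h" "open S"
  shows "C_k_on k f S \<Longrightarrow> C_k_on k (\<lambda>x. h (f x)) S"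
proof (induction k arbitrary: f)
  case 0
  then show ?case using assms
    by (auto intro: bounded_linear.continuous_on)
next
  case (Suc k)
  have hd: "((\<lambda>x. h (f x)) has_derivative (\<lambda>v. h (frechet_derivative f (at x) v))) (at x)" if "x \<in> S" for x
    using that Suc.prems by (intro bounded_linear.has_derivative[OF assms(1)] differentiable_has) auto
  have d: "frechet_derivative (\<lambda>x. h (f x)) (at x) v = h (frechet_derivative f (at x) v)" if "x \<in> S" for x v
    using frechet_eqI[OF hd[OF that]] by simp
  have "C_k_on k (\<lambda>x. frechet_derivative (\<lambda>x. h (f x)) (at x) v) S" for v
    by (rule iffD2[OF C_k_on_cong[OF assms(2)]], erule d) (use Suc in auto)
  then show ?case using hd by (auto simp: differentiable_def)
qed

lemma C_k_on_scaleR_linear: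
  fixes c :: "'a::real_normed_vector \<Rightarrow> real"
  assumes "bounded_linear c" "open S"
  shows "C_k_on k f S \<Longrightarrow> C_k_on k (\<lambda>x. c x *\<^sub>R f x) S"
proof (induction k arbitrary: f)
  case 0
  then show ?case using assms
    by (simp add: continuous_on_scaleR linear_continuous_on)
next
  case (Suc k)
  have hd: "((\<lambda>x. c x *\<^sub>R f x) has_derivative (\<lambda>v. c x *\<^sub>R frechet_derivative f (at x) v + c v *\<^sub>R f x)) (at x)" if "x \<in> S" for x
    using that Suc.prems
    by (intro has_derivative_scaleR bounded_linear_imp_has_derivative[OF assms(1)] differentiable_has) auto
  have d: "frechet_derivative (\<lambda>x. c x *\<^sub>R f x) (at x) v = c x *\<^sub>R frechet_derivative f (at x) v + c v *\<^sub>R f x" if "x \<in> S" for x v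
    using frechet_eqI[OF hd[OF that]] by simp
  have "C_k_on k (\<lambda>x. frechet_derivative (\<lambda>x. c x *\<^sub>R f x) (at x) v) S" for v
  proof (rule iffD2[OF C_k_on_cong[OF assms(2)]], erule d)
    have "C_k_on k (\<lambda>x. frechet_derivative f (at x) v) S"
      using Suc.prems by simp
    then show "C_k_on k (\<lambda>x. c x *\<^sub>R frechet_derivative f (at x) v + c v *\<^sub>R f x) S"
      by (intro C_k_on_add assms(2) Suc.IH C_k_on_linear[OF bounded_linear_scaleR_right] C_k_on_Suc_imp[OF Suc.prems])
  qed
  then show ?case using hd by (auto simp: differentiable_def)
qed

lemma C_k_on_zero: "C_k_on k (\<lambda>x. 0) S"
  by (induction k) (auto)

lemma C_k_on_const: "C_k_on k (\<lambda>x. c) S"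
  by (cases k) (auto simp: C_k_on_zero)

lemma C_k_on_sum:
  assumes "open S" "\<And>i. i \<in> I \<Longrightarrow> C_k_on k (f i) S"
  shows "C_k_on k (\<lambda>x. \<Sum>i\<in>I. f i x) S"
  using assms(2) by (induction I rule: infinite_finite_induct) (auto simp: C_k_on_zero C_k_on_add assms(1))

lemma smooth_on_deriv: "smooth_on S f \<Longrightarrow> smooth_on S (\<lambda>x. frechet_derivative f (at x) v)"
  unfolding smooth_on_def by (metis C_k_on.simps(2))

lemma smooth_on_has_derivative:
  "smooth_on S f \<Longrightarrow> x \<in> S \<Longrightarrow> (f has_derivative frechet_derivative f (at x)) (at x)"
  unfolding smooth_on_def by (metis C_k_on.simps(2) differentiable_has)

subsection \<open>Symmetry of second derivatives\<close>

lemma second_difference: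
  fixes f :: "'a::real_normed_vector \<Rightarrow> real"
  assumes h: "h > 0"
    and S: "\<And>s t. 0 \<le> s \<Longrightarrow> s \<le> h \<Longrightarrow> 0 \<le> t \<Longrightarrow> t \<le> h \<Longrightarrow> x + s *\<^sub>R u + t *\<^sub>R v \<in> S"
    and f: "\<And>y. y \<in> S \<Longrightarrow> (f has_derivative f' y) (at y)"
    and fu: "\<And>y. y \<in> S \<Longrightarrow> ((\<lambda>y. f' y u) has_derivative fu y) (at y)"
  obtains s t where "0 < s" "s < h" "0 < t" "t < h"
    "f (x + h *\<^sub>R u + h *\<^sub>R v) - f (x + h *\<^sub>R u) - f (x + h *\<^sub>R v) + f x
      = h * h * fu (x + s *\<^sub>R u + t *\<^sub>R v) v"
proof -
  have lin: "f' y (r *\<^sub>R w) = r * f' y w" if "y \<in> S" for y r w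
    using has_derivative_linear[OF f[OF that]] by (simp add: linear_cmul)
  have linu: "fu y (r *\<^sub>R w) = r * fu y w" if "y \<in> S" for y r w
    using has_derivative_linear[OF fu[OF that]] by (simp add: linear_cmul)
  have d1: "((\<lambda>s. f (x + s *\<^sub>R u + t *\<^sub>R v)) has_real_derivative f' (x + s *\<^sub>R u + t *\<^sub>R v) u) (at s)"
    if "0 \<le> s" "s \<le> h" "0 \<le> t" "t \<le> h" for s t
  proof -
    have "((\<lambda>s. f (x + s *\<^sub>R u + t *\<^sub>R v)) has_derivative (\<lambda>r. f' (x + s *\<^sub>R u + t *\<^sub>R v) (r *\<^sub>R u))) (at s)"
      by (rule has_derivative_compose[where g = f and f = "\<lambda>s. x + s *\<^sub>R u + t *\<^sub>R v", OF _ f[OF S]]) (use that in \<open>auto intro!: derivative_eq_intros\<close>)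
    then show ?thesis
      by (rule has_derivative_imp_has_field_derivative) (simp add: lin[OF S] that)
  qed
  have d2: "((\<lambda>t. f' (x + s *\<^sub>R u + t *\<^sub>R v) u) has_real_derivative fu (x + s *\<^sub>R u + t *\<^sub>R v) v) (at t)"
    if "0 \<le> s" "s \<le> h" "0 \<le> t" "t \<le> h" for s t
  proof -
    have "((\<lambda>t. f' (x + s *\<^sub>R u + t *\<^sub>R v) u) has_derivative (\<lambda>r. fu (x + s *\<^sub>R u + t *\<^sub>R v) (r *\<^sub>R v))) (at t)"
      by (rule has_derivative_compose[where g = "\<lambda>y. f' y u" and f = "\<lambda>t. x + s *\<^sub>R u + t *\<^sub>R v", OF _ fu[OF S]]) (use that in \<open>auto intro!: derivative_eq_intros\<close>)
    then show ?thesis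
      by (rule has_derivative_imp_has_field_derivative) (simp add: linu[OF S] that)
  qed
  have "\<exists>s>0. s < h \<and> (f (x + h *\<^sub>R u + h *\<^sub>R v) - f (x + h *\<^sub>R u + 0 *\<^sub>R v)) - (f (x + 0 *\<^sub>R u + h *\<^sub>R v) - f (x + 0 *\<^sub>R u + 0 *\<^sub>R v))
     = (h - 0) * (f' (x + s *\<^sub>R u + h *\<^sub>R v) u - f' (x + s *\<^sub>R u + 0 *\<^sub>R v) u)"
    by (rule MVT2[OF h, where f = "\<lambda>s. f (x + s *\<^sub>R u + h *\<^sub>R v) - f (x + s *\<^sub>R u + 0 *\<^sub>R v)"
          and f' = "\<lambda>s. f' (x + s *\<^sub>R u + h *\<^sub>R v) u - f' (x + s *\<^sub>R u + 0 *\<^sub>R v) u"])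
       (use h in \<open>auto intro!: DERIV_diff d1 d1[where t=0, simplified]\<close>)
  then obtain s where s: "0 < s" "s < h"
     "(f (x + h *\<^sub>R u + h *\<^sub>R v) - f (x + h *\<^sub>R u)) - (f (x + h *\<^sub>R v) - f x)
     = h * (f' (x + s *\<^sub>R u + h *\<^sub>R v) u - f' (x + s *\<^sub>R u) u)" by auto
  have "\<exists>t>0. t < h \<and> f' (x + s *\<^sub>R u + h *\<^sub>R v) u - f' (x + s *\<^sub>R u + 0 *\<^sub>R v) u = (h - 0) * fu (x + s *\<^sub>R u + t *\<^sub>R v) v"
    by (rule MVT2[OF h]) (use s in \<open>auto intro!: d2\<close>)
  then obtain t where t: "0 < t" "t < h" "f' (x + s *\<^sub>R u + h *\<^sub>R v) u - f' (x + s *\<^sub>R u) u = h * fu (x + s *\<^sub>R u + t *\<^sub>R v) v" by auto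
  show thesis
    by (rule that[OF s(1,2) t(1,2)]) (use s(3) t(3) in \<open>simp add: algebra_simps\<close>)
qed

lemma symmetric_second_real:
  fixes f :: "'a::real_normed_vector \<Rightarrow> real"
  assumes S: "open S" "x \<in> S"
    and f: "\<And>y. y \<in> S \<Longrightarrow> (f has_derivative f' y) (at y)"
    and fu: "\<And>y. y \<in> S \<Longrightarrow> ((\<lambda>y. f' y u) has_derivative fu y) (at y)"
    and fv: "\<And>y. y \<in> S \<Longrightarrow> ((\<lambda>y. f' y v) has_derivative fv y) (at y)"
    and cu: "continuous_on S (\<lambda>y. fu y v)" and cv: "continuous_on S (\<lambda>y. fv y u)"
  shows "fu x v = fv x u"
proof (rule ccontr)
  assume neq: "fu x v \<noteq> fv x u"
  define e where "e = \<bar>fu x v - fv x u\<bar> / 2"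
  have e: "e > 0" using neq by (simp add: e_def)
  have "isCont (\<lambda>y. fu y v) x" "isCont (\<lambda>y. fv y u) x"
    using cu cv S by (simp_all add: continuous_on_eq_continuous_at)
  then obtain d1 d2 where d: "d1 > 0" "\<And>y. dist y x < d1 \<Longrightarrow> dist (fu y v) (fu x v) < e"
     "d2 > 0" "\<And>y. dist y x < d2 \<Longrightarrow> dist (fv y u) (fv x u) < e"
    using e unfolding continuous_at_eps_delta by metis
  obtain d3 where d3: "d3 > 0" "\<And>y. dist y x < d3 \<Longrightarrow> y \<in> S"
    using S unfolding open_dist by blast
  define d where "d = min d1 (min d2 d3)"
  have "d > 0" using d d3 by (simp add: d_def)
  define h where "h = d / (2 * (norm u + norm v + 1))"
  have np: "norm u + norm v + 1 > 0"
    using norm_ge_zero[of u] norm_ge_zero[of v] by linarith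
  have h: "h > 0" using \<open>d > 0\<close> np by (simp add: h_def)
  have hd: "h * (norm u + norm v + 1) < d"
  proof -
    have "h * N = d / 2" if "N = norm u + norm v + 1" for N
      using np unfolding h_def that[symmetric] by simp
    from this[OF refl] show ?thesis using \<open>d > 0\<close> by simp
  qed
  have near: "dist (x + s *\<^sub>R u + t *\<^sub>R v) x < d" "dist (x + t *\<^sub>R v + s *\<^sub>R u) x < d"
    if "0 \<le> s" "s \<le> h" "0 \<le> t" "t \<le> h" for s t
  proof -
    have "norm (s *\<^sub>R u + t *\<^sub>R v) \<le> s * norm u + t * norm v"
      using norm_triangle_ineq[of "s *\<^sub>R u" "t *\<^sub>R v"] that by simp
    also have "\<dots> \<le> h * norm u + h * norm v"
      using that by (intro add_mono mult_right_mono) auto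
    also have "\<dots> \<le> h * (norm u + norm v + 1)" using h by (simp add: algebra_simps)
    also have "\<dots> < d" by (rule hd)
    finally show "dist (x + s *\<^sub>R u + t *\<^sub>R v) x < d" "dist (x + t *\<^sub>R v + s *\<^sub>R u) x < d"
      by (simp_all add: dist_norm add.commute)
  qed
  obtain s t where st: "0 < s" "s < h" "0 < t" "t < h"
    "f (x + h *\<^sub>R u + h *\<^sub>R v) - f (x + h *\<^sub>R u) - f (x + h *\<^sub>R v) + f x
      = h * h * fu (x + s *\<^sub>R u + t *\<^sub>R v) v"
    by (rule second_difference[OF h _ f fu, where x=x and v=v]) (use near(1) d3 in \<open>auto simp: d_def\<close>)
  obtain s' t' where st': "0 < s'" "s' < h" "0 < t'" "t' < h"
    "f (x + h *\<^sub>R v + h *\<^sub>R u) - f (x + h *\<^sub>R v) - f (x + h *\<^sub>R u) + f x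
      = h * h * fv (x + s' *\<^sub>R v + t' *\<^sub>R u) u"
    by (rule second_difference[OF h _ f fv, where x=x and v=u]) (use near(2) d3 in \<open>auto simp: d_def\<close>)
  have eq: "x + h *\<^sub>R v + h *\<^sub>R u = x + h *\<^sub>R u + h *\<^sub>R v" by simp
  have "h * h * fu (x + s *\<^sub>R u + t *\<^sub>R v) v = h * h * fv (x + s' *\<^sub>R v + t' *\<^sub>R u) u"
    using st(5) st'(5)[unfolded eq] by linarith
  then have eq: "fu (x + s *\<^sub>R u + t *\<^sub>R v) v = fv (x + s' *\<^sub>R v + t' *\<^sub>R u) u"
    using h by simp
  have "dist (fu (x + s *\<^sub>R u + t *\<^sub>R v) v) (fu x v) < e"
    using near(1)[of s t] st by (intro d) (auto simp: d_def)
  moreover have "dist (fv (x + s' *\<^sub>R v + t' *\<^sub>R u) u) (fv x u) < e"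
    using near(2)[of t' s'] st' by (intro d) (auto simp: d_def)
  ultimately show False using eq by (auto simp: dist_real_def e_def abs_if split: if_splits)
qed

lemma smooth_on_symmetric:
  fixes f :: "'a::real_normed_vector \<Rightarrow> complex"
  assumes S: "open S" "x \<in> S" and f: "smooth_on S f"
  shows "frechet_derivative (\<lambda>y. frechet_derivative f (at y) u) (at x) v
       = frechet_derivative (\<lambda>y. frechet_derivative f (at y) v) (at x) u" (is "?l = ?r")
proof -
  note D = smooth_on_has_derivative
  have c: "continuous_on S (\<lambda>y. frechet_derivative (\<lambda>y. frechet_derivative f (at y) u) (at y) v)" for u v
    using smooth_on_deriv[OF smooth_on_deriv[OF f]] C_k_on.simps(1) unfolding smooth_on_def by metis
  have "p ?l = p ?r" if p: "bounded_linear p" for p :: "complex \<Rightarrow> real"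
    by (rule symmetric_second_real[OF S, where f = "\<lambda>y. p (f y)" and f' = "\<lambda>y w. p (frechet_derivative f (at y) w)"
         and fu = "\<lambda>y w. p (frechet_derivative (\<lambda>y. frechet_derivative f (at y) u) (at y) w)"
         and fv = "\<lambda>y w. p (frechet_derivative (\<lambda>y. frechet_derivative f (at y) v) (at y) w)"])
       (auto intro!: bounded_linear.has_derivative[OF p] D[OF f] D[OF smooth_on_deriv[OF f]]
          bounded_linear.continuous_on[OF p] c)
  from this[OF bounded_linear_Re] this[OF bounded_linear_Im] show ?thesis
    by (simp add: complex_eq_iff)
qed


section \<open>The action of words in gl(4,C) on functions on GL(4,R)\<close>

type_synonym mat4 = "real^4^4"
type_synonym gl4 = "complex^4^4"

definition GL4 :: "mat4 set" where
  "GL4 = {g. invertible g}"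

lemma open_GL4: "open GL4"
proof -
  have "continuous_on UNIV (det :: mat4 \<Rightarrow> real)"
    unfolding det_def by (intro continuous_intros)
  then have "open {g::mat4. det g \<noteq> 0}"
    by (intro open_Collect_neq continuous_intros)
  then show ?thesis by (simp add: GL4_def invertible_det_nz)
qed

definition R_real :: "mat4 \<Rightarrow> (mat4 \<Rightarrow> complex) \<Rightarrow> mat4 \<Rightarrow> complex" where
  "R_real X f g = vector_derivative (\<lambda>t. f (g ** mexp (t *\<^sub>R X))) (at 0)"

definition R_gl :: "gl4 \<Rightarrow> (mat4 \<Rightarrow> complex) \<Rightarrow> mat4 \<Rightarrow> complex" where
  "R_gl X f g = R_real (map_matrix Re X) f g + \<i> * R_real (map_matrix Im X) f g"

text \<open>The monoid operation (written additively, as for exponents of monomials) is concatenation,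
  so finitely supported functions on words form the free associative algebra.\<close>

datatype 'a word = Word (letters: "'a list")

instantiation word :: (type) monoid_add
begin
definition "0 = Word []"
definition "v + w = Word (letters v @ letters w)"
instance by standard (simp_all add: zero_word_def plus_word_def)
end

type_synonym gl4_free = "gl4 word \<Rightarrow>\<^sub>0 complex"

definition R_word :: "gl4 word \<Rightarrow> (mat4 \<Rightarrow> complex) \<Rightarrow> mat4 \<Rightarrow> complex" where
  "R_word w f = foldr R_gl (letters w) f"

text \<open>The word \<open>X\<^sub>1\<dots>X\<^sub>m\<close> acts by \<open>R\<^bsub>X\<^sub>1\<^esub> \<circ> \<dots> \<circ> R\<^bsub>X\<^sub>m\<^esub>\<close>.\<close>

definition R_free :: "gl4_free \<Rightarrow> (mat4 \<Rightarrow> complex) \<Rightarrow> mat4 \<Rightarrow> complex" where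
  "R_free p f g = (\<Sum>w\<in>Poly_Mapping.keys p. Poly_Mapping.lookup p w * R_word w f g)"

definition free_gen :: "gl4 \<Rightarrow> gl4_free" where
  "free_gen X = Poly_Mapping.single (Word [X]) 1"

definition free_const :: "complex \<Rightarrow> gl4_free" where
  "free_const c = Poly_Mapping.single 0 c"

text \<open>The two-sided ideal defining the enveloping algebra. The tensor algebra of gl(4,C) is the
  free algebra on the underlying set modulo the first two kinds of relations (linearity of the
  generators); the third kind imposes \<open>XY - YX = [X,Y]\<close>.\<close>

inductive_set ug_rel :: "gl4_free set" where
  add: "free_gen (X + Y) - free_gen X - free_gen Y \<in> ug_rel"
| scale: "free_gen (map_matrix ((*) c) X) - free_const c * free_gen X \<in> ug_rel"
| bracket: "free_gen X * free_gen Y - free_gen Y * free_gen X - free_gen (X ** Y - Y ** X) \<in> ug_rel"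
| sum: "p \<in> ug_rel \<Longrightarrow> q \<in> ug_rel \<Longrightarrow> p + q \<in> ug_rel"
| lmult: "p \<in> ug_rel \<Longrightarrow> r * p \<in> ug_rel"
| rmult: "p \<in> ug_rel \<Longrightarrow> p * r \<in> ug_rel"

section \<open>The action kills the relations on smooth functions\<close>

abbreviation "smooth_GL4 \<equiv> smooth_on GL4"
abbreviation deriv_at where "deriv_at f g \<equiv> frechet_derivative f (at g)"

lemma R_real_eq:
  assumes "smooth_GL4 f" "g \<in> GL4"
  shows "R_real X f g = deriv_at f g (g ** X)"
proof -
  have "((\<lambda>t. g ** mexp (t *\<^sub>R X)) has_derivative (\<lambda>t. g ** (t *\<^sub>R X))) (at 0)"
    using bounded_linear.has_derivative[OF bounded_linear_matrix_mult_left
      mexp_has_vector_derivative[unfolded has_vector_derivative_def]] .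
  moreover have "(f has_derivative deriv_at f g) (at (g ** mexp (0 *\<^sub>R X)))"
    using smooth_on_has_derivative[OF assms] by simp
  ultimately have "((\<lambda>t. f (g ** mexp (t *\<^sub>R X))) has_derivative (\<lambda>t. deriv_at f g (g ** (t *\<^sub>R X)))) (at 0)"
    by (rule has_derivative_compose)
  moreover have "deriv_at f g (g ** (t *\<^sub>R X)) = t *\<^sub>R deriv_at f g (g ** X)" for t
    using has_derivative_linear[OF smooth_on_has_derivative[OF assms]]
      linear_cmul[OF linear_conv_bounded_linear[THEN iffD2, OF bounded_linear_matrix_mult_left[of g]]]
    by (simp add: linear_cmul)
  ultimately show ?thesis
    unfolding R_real_def by (intro vector_derivative_at) (simp add: has_vector_derivative_def)
qed

lemma D_basis:
  assumes "smooth_GL4 f" "g \<in> GL4"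
  shows "deriv_at f g w = (\<Sum>b\<in>Basis. (w \<bullet> b) *\<^sub>R deriv_at f g b)"
proof -
  have l: "linear (deriv_at f g)" by (rule has_derivative_linear[OF smooth_on_has_derivative[OF assms]])
  have "deriv_at f g (\<Sum>b\<in>Basis. (w \<bullet> b) *\<^sub>R b) = (\<Sum>b\<in>Basis. deriv_at f g ((w \<bullet> b) *\<^sub>R b))"
    by (rule linear_sum[OF l])
  then show ?thesis by (simp only: euclidean_representation linear_cmul[OF l])
qed

lemma R_real_basis:
  assumes "smooth_GL4 f" "g \<in> GL4"
  shows "R_real X f g = (\<Sum>b\<in>Basis. ((g ** X) \<bullet> b) *\<^sub>R deriv_at f g b)"
  unfolding R_real_eq[OF assms] by (rule D_basis[OF assms])

lemma bounded_linear_matrix_mult_right: "bounded_linear (\<lambda>Y::real^'n^'n. Y ** X)"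
  by (intro linear_conv_bounded_linear[THEN iffD1] linearI)
     (simp_all add: vec_eq_iff matrix_matrix_mult_def sum_distrib_left sum.distrib distrib_right mult.assoc)

lemma bounded_linear_mult_inner: "bounded_linear (\<lambda>Y::real^'n^'n. (Y ** X) \<bullet> b)"
  by (rule bounded_linear_compose[where f = "\<lambda>Z. Z \<bullet> b" and g = "\<lambda>Y. Y ** X"])
     (simp_all add: bounded_linear_inner_left bounded_linear_matrix_mult_right)

lemma smooth_R_real_basis:
  assumes "smooth_GL4 f"
  shows "smooth_GL4 (\<lambda>g. \<Sum>b\<in>Basis. ((g ** X) \<bullet> b) *\<^sub>R deriv_at f g b)"
proof -
  have "C_k_on k (\<lambda>g. deriv_at f g b) GL4" for k b
    using smooth_on_deriv[OF assms] by (simp add: smooth_on_def)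
  moreover note bounded_linear_mult_inner
  ultimately show ?thesis
    unfolding smooth_on_def by (intro allI C_k_on_sum open_GL4 C_k_on_scaleR_linear)
qed

lemma smooth_R_real:
  assumes "smooth_GL4 f"
  shows "smooth_GL4 (R_real X f)"
  by (subst smooth_on_cong[OF open_GL4, of _ "\<lambda>g. \<Sum>b\<in>Basis. ((g ** X) \<bullet> b) *\<^sub>R deriv_at f g b"])
     (simp_all add: R_real_basis assms smooth_R_real_basis)

lemma D_R_real:
  assumes "smooth_GL4 f" "g \<in> GL4"
  shows "deriv_at (R_real Y f) g v = deriv_at (\<lambda>h. deriv_at f h (g ** Y)) g v + deriv_at f g (v ** Y)"
proof -
  note hd = smooth_on_has_derivative[OF smooth_on_deriv[OF assms(1)] assms(2)]
  have 1: "deriv_at (R_real Y f) g = deriv_at (\<lambda>h. \<Sum>b\<in>Basis. ((h ** Y) \<bullet> b) *\<^sub>R deriv_at f h b) g"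
    by (rule frechet_cong[OF open_GL4 assms(2)])
       (simp add: R_real_basis assms)
  have 2: "deriv_at (\<lambda>h. \<Sum>b\<in>Basis. ((h ** Y) \<bullet> b) *\<^sub>R deriv_at f h b) g
     = (\<lambda>v. \<Sum>b\<in>Basis. ((g ** Y) \<bullet> b) *\<^sub>R deriv_at (\<lambda>h. deriv_at f h b) g v + ((v ** Y) \<bullet> b) *\<^sub>R deriv_at f g b)"
    by (rule frechet_eqI)
       (intro has_derivative_sum has_derivative_scaleR hd
         bounded_linear_imp_has_derivative bounded_linear_mult_inner)
  have 3: "deriv_at (\<lambda>h. deriv_at f h (g ** Y)) g = deriv_at (\<lambda>h. \<Sum>b\<in>Basis. ((g ** Y) \<bullet> b) *\<^sub>R deriv_at f h b) g"
    by (rule frechet_cong[OF open_GL4 assms(2)]) (rule D_basis[OF assms(1)])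
  have 4: "deriv_at (\<lambda>h. \<Sum>b\<in>Basis. ((g ** Y) \<bullet> b) *\<^sub>R deriv_at f h b) g
     = (\<lambda>v. \<Sum>b\<in>Basis. ((g ** Y) \<bullet> b) *\<^sub>R deriv_at (\<lambda>h. deriv_at f h b) g v)"
    by (rule frechet_eqI) (intro has_derivative_sum has_derivative_scaleR_right hd)
  show ?thesis
    unfolding 1 2 3 4 by (simp add: sum.distrib D_basis[OF assms, of "v ** Y"])
qed

lemma linear_D: "smooth_GL4 f \<Longrightarrow> g \<in> GL4 \<Longrightarrow> linear (deriv_at f g)"
  by (rule has_derivative_linear[OF smooth_on_has_derivative])

lemma R_real_add_left: "smooth_GL4 f \<Longrightarrow> g \<in> GL4 \<Longrightarrow> R_real (X + Y) f g = R_real X f g + R_real Y f g"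
  by (simp add: R_real_eq matrix_add_ldistrib linear_add[OF linear_D])

lemma R_real_diff_left: "smooth_GL4 f \<Longrightarrow> g \<in> GL4 \<Longrightarrow> R_real (X - Y) f g = R_real X f g - R_real Y f g"
  by (metis R_real_add_left add_diff_cancel diff_add_cancel)

lemma R_real_scale_left: "smooth_GL4 f \<Longrightarrow> g \<in> GL4 \<Longrightarrow> R_real (c *\<^sub>R X) f g = c *\<^sub>R R_real X f g"
  using linear_cmul[OF linear_conv_bounded_linear[THEN iffD2, OF bounded_linear_matrix_mult_left[of g]]]
  by (simp add: R_real_eq linear_cmul[OF linear_D])

lemma R_real_bracket:
  assumes "smooth_GL4 f" "g \<in> GL4"
  shows "R_real X (R_real Y f) g - R_real Y (R_real X f) g = R_real (X ** Y - Y ** X) f g"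
proof -
  have e: "R_real X (R_real Y f) g = deriv_at (\<lambda>h. deriv_at f h (g ** Y)) g (g ** X) + R_real (X ** Y) f g" for X Y
    by (simp add: R_real_eq[OF smooth_R_real] assms D_R_real R_real_eq matrix_mul_assoc)
  show ?thesis
    unfolding e R_real_diff_left[OF assms]
    using smooth_on_symmetric[OF open_GL4 assms(2,1), of "g ** X" "g ** Y"] by simp
qed

lemma smooth_cong: "(\<And>g. g \<in> GL4 \<Longrightarrow> f g = f' g) \<Longrightarrow> smooth_GL4 f \<longleftrightarrow> smooth_GL4 f'"
  by (rule smooth_on_cong[OF open_GL4])

lemma smooth_lincomb:
  fixes f :: "'i \<Rightarrow> mat4 \<Rightarrow> complex"
  assumes "\<And>i. i \<in> I \<Longrightarrow> smooth_GL4 (f i)"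
  shows "smooth_GL4 (\<lambda>g. \<Sum>i\<in>I. c i * f i g)"
  unfolding smooth_on_def
proof (intro allI C_k_on_sum open_GL4)
  fix k i assume "i \<in> I"
  then have "C_k_on k (f i) GL4" using assms by (simp add: smooth_on_def)
  then show "C_k_on k (\<lambda>x. c i * f i x) GL4"
    using C_k_on_linear[where h = "\<lambda>z. c i * z" and f = "f i", OF bounded_linear_mult_right open_GL4] by simp
qed

lemma R_real_lincomb:
  fixes f :: "'i \<Rightarrow> mat4 \<Rightarrow> complex"
  assumes "\<And>i. i \<in> I \<Longrightarrow> smooth_GL4 (f i)" "g \<in> GL4"
  shows "R_real X (\<lambda>g. \<Sum>i\<in>I. c i * f i g) g = (\<Sum>i\<in>I. c i * R_real X (f i) g)"
proof -
  have "deriv_at (\<lambda>g. \<Sum>i\<in>I. c i * f i g) g = (\<lambda>v. \<Sum>i\<in>I. c i * deriv_at (f i) g v)"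
    by (rule frechet_eqI)
       (intro has_derivative_sum has_derivative_mult_right smooth_on_has_derivative[where S = GL4] assms)
  then show ?thesis using assms by (simp add: R_real_eq smooth_lincomb)
qed

lemma R_real_cong:
  assumes "\<And>g. g \<in> GL4 \<Longrightarrow> f g = f' g" "smooth_GL4 f" "g \<in> GL4"
  shows "R_real X f g = R_real X f' g"
  using assms smooth_cong[OF assms(1)] frechet_cong[OF open_GL4 assms(3,1)] by (simp add: R_real_eq)

lemma R_gl_cong:
  assumes "\<And>g. g \<in> GL4 \<Longrightarrow> f g = f' g" "smooth_GL4 f" "g \<in> GL4"
  shows "R_gl X f g = R_gl X f' g"
  using R_real_cong[OF assms] by (simp add: R_gl_def)

lemma R_gl_lincomb:
  assumes "\<And>i. i \<in> I \<Longrightarrow> smooth_GL4 (f i)" "g \<in> GL4"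
  shows "R_gl X (\<lambda>g. \<Sum>i\<in>I. c i * f i g) g = (\<Sum>i\<in>I. c i * R_gl X (f i) g)"
  using assms by (simp add: R_gl_def R_real_lincomb sum.distrib sum_distrib_left algebra_simps)

lemma R_gl_fun: "R_gl X f = (\<lambda>g. \<Sum>b\<in>UNIV. (if b then 1 else \<i>) * R_real (if b then map_matrix Re X else map_matrix Im X) f g)"
  by (auto simp: R_gl_def UNIV_bool)

lemma smooth_R_gl: "smooth_GL4 f \<Longrightarrow> smooth_GL4 (R_gl X f)"
  unfolding R_gl_fun by (intro smooth_lincomb smooth_R_real)

lemma R_real_R_gl:
  assumes "smooth_GL4 f" "g \<in> GL4"
  shows "R_real X (R_gl Y f) g = R_real X (R_real (map_matrix Re Y) f) g + \<i> * R_real X (R_real (map_matrix Im Y) f) g"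
  unfolding R_gl_fun by (subst R_real_lincomb) (auto simp: assms smooth_R_real UNIV_bool)

lemma R_gl_bracket:
  assumes "smooth_GL4 f" "g \<in> GL4"
  shows "R_gl X (R_gl Y f) g - R_gl Y (R_gl X f) g = R_gl (X ** Y - Y ** X) f g"
proof -
  let ?a = "map_matrix Re X" and ?b = "map_matrix Im X" and ?c = "map_matrix Re Y" and ?d = "map_matrix Im Y"
  have re: "map_matrix Re (X ** Y - Y ** X) = (?a ** ?c - ?c ** ?a) - (?b ** ?d - ?d ** ?b)"
    and im: "map_matrix Im (X ** Y - Y ** X) = (?a ** ?d - ?d ** ?a) + (?b ** ?c - ?c ** ?b)"
    by (auto simp: vec_eq_iff map_matrix_def matrix_matrix_mult_def sum.distrib sum_subtractf algebra_simps)
  show ?thesis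
    unfolding R_gl_def[of "X ** Y - Y ** X"] re im
      R_real_add_left[OF assms] R_real_diff_left[OF assms, of "_ ** _ - _ ** _" "_ ** _ - _ ** _"]
      R_real_bracket[OF assms, symmetric]
    by (simp add: R_gl_def[of X "R_gl Y f"] R_gl_def[of Y "R_gl X f"] R_real_R_gl[OF assms] algebra_simps)
qed

lemma R_gl_add: "smooth_GL4 f \<Longrightarrow> g \<in> GL4 \<Longrightarrow> R_gl (X + Y) f g = R_gl X f g + R_gl Y f g"
proof -
  have "map_matrix Re (X + Y) = map_matrix Re X + map_matrix Re Y"
    "map_matrix Im (X + Y) = map_matrix Im X + map_matrix Im Y"
    by (simp_all add: vec_eq_iff map_matrix_def)
  then show "smooth_GL4 f \<Longrightarrow> g \<in> GL4 \<Longrightarrow> ?thesis"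
    by (simp add: R_gl_def R_real_add_left algebra_simps)
qed

lemma R_gl_scale: "smooth_GL4 f \<Longrightarrow> g \<in> GL4 \<Longrightarrow> R_gl (map_matrix ((*) c) X) f g = c * R_gl X f g"
proof -
  have "map_matrix Re (map_matrix ((*) c) X) = Re c *\<^sub>R map_matrix Re X - Im c *\<^sub>R map_matrix Im X"
    "map_matrix Im (map_matrix ((*) c) X) = Re c *\<^sub>R map_matrix Im X + Im c *\<^sub>R map_matrix Re X"
    by (simp_all add: vec_eq_iff map_matrix_def)
  then show "smooth_GL4 f \<Longrightarrow> g \<in> GL4 \<Longrightarrow> ?thesis"
    by (simp add: R_gl_def R_real_add_left R_real_diff_left R_real_scale_left)
       (simp add: complex_eq_iff algebra_simps)
qed

lemma smooth_foldr: "smooth_GL4 f \<Longrightarrow> smooth_GL4 (foldr R_gl l f)"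
  by (induction l) (auto intro: smooth_R_gl)

lemma smooth_R_word: "smooth_GL4 f \<Longrightarrow> smooth_GL4 (R_word w f)"
  by (simp add: R_word_def smooth_foldr)

lemma smooth_R_free: "smooth_GL4 f \<Longrightarrow> smooth_GL4 (R_free p f)"
  unfolding R_free_def by (intro smooth_lincomb smooth_R_word)

lemma R_word_lincomb:
  assumes "\<And>i. i \<in> I \<Longrightarrow> smooth_GL4 (f i)" "g \<in> GL4"
  shows "R_word w (\<lambda>g. \<Sum>i\<in>I. c i * f i g) g = (\<Sum>i\<in>I. c i * R_word w (f i) g)"
proof -
  have "foldr R_gl l (\<lambda>g. \<Sum>i\<in>I. c i * f i g) g = (\<Sum>i\<in>I. c i * foldr R_gl l (f i) g)" if "g \<in> GL4" for l g
    using that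
  proof (induction l arbitrary: g)
    case (Cons X l)
    have "foldr R_gl (X # l) (\<lambda>g. \<Sum>i\<in>I. c i * f i g) g
        = R_gl X (\<lambda>g. \<Sum>i\<in>I. c i * foldr R_gl l (f i) g) g"
      using Cons by (simp, intro R_gl_cong smooth_foldr smooth_lincomb assms) auto
    also have "\<dots> = (\<Sum>i\<in>I. c i * R_gl X (foldr R_gl l (f i)) g)"
      by (intro R_gl_lincomb smooth_foldr assms Cons.prems)
    finally show ?case by simp
  qed simp
  then show ?thesis using assms by (simp add: R_word_def)
qed

lemma R_word_cong:
  assumes "\<And>g. g \<in> GL4 \<Longrightarrow> f g = f' g" "smooth_GL4 f" "g \<in> GL4"
  shows "R_word w f g = R_word w f' g"
proof -
  have "foldr R_gl l f g = foldr R_gl l f' g" if "g \<in> GL4" for l g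
    using that
    by (induction l arbitrary: g) (auto simp: assms(1) intro!: R_gl_cong smooth_foldr assms(2))
  then show ?thesis using assms by (simp add: R_word_def)
qed

lemma R_free_cong:
  assumes "\<And>g. g \<in> GL4 \<Longrightarrow> f g = f' g" "smooth_GL4 f" "g \<in> GL4"
  shows "R_free p f g = R_free p f' g"
  unfolding R_free_def using R_word_cong[OF assms] by simp

lemma R_word_plus: "R_word (v + w) f = R_word v (R_word w f)"
  by (simp add: R_word_def plus_word_def)

lemma R_free_superset:
  "finite A \<Longrightarrow> Poly_Mapping.keys p \<subseteq> A \<Longrightarrow> R_free p f g = (\<Sum>w\<in>A. Poly_Mapping.lookup p w * R_word w f g)"
  unfolding R_free_def by (rule sum.mono_neutral_left) (auto simp: in_keys_iff)

lemma R_free_add: "R_free (p + q) f g = R_free p f g + R_free q f g"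
proof -
  let ?A = "Poly_Mapping.keys p \<union> Poly_Mapping.keys q"
  have "R_free r f g = (\<Sum>w\<in>?A. Poly_Mapping.lookup r w * R_word w f g)" if "r \<in> {p, q, p + q}" for r
    using that keys_add[of p q] by (intro R_free_superset) auto
  then show ?thesis by (simp add: lookup_add sum.distrib algebra_simps)
qed

lemma R_free_zero [simp]: "R_free 0 f g = 0"
  by (simp add: R_free_def)

lemma R_free_diff: "R_free (p - q) f g = R_free p f g - R_free q f g"
  using R_free_add[of "p - q" q f g] by simp

lemma R_free_sum: "R_free (\<Sum>i\<in>I. p i) f g = (\<Sum>i\<in>I. R_free (p i) f g)"
  by (induction I rule: infinite_finite_induct) (auto simp: R_free_add)

lemma R_free_single: "R_free (Poly_Mapping.single w c) f g = c * R_word w f g"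
  by (simp add: R_free_def)

lemma poly_mapping_sum_single: "(\<Sum>w\<in>Poly_Mapping.keys p. Poly_Mapping.single w (Poly_Mapping.lookup p w)) = p"
  by (rule poly_mapping_eqI)
     (auto simp: lookup_sum lookup_single when_def in_keys_iff)

lemma R_free_mult:
  assumes "smooth_GL4 f" "g \<in> GL4"
  shows "R_free (p * q) f g = R_free p (R_free q f) g"
proof -
  let ?K = Poly_Mapping.keys and ?l = Poly_Mapping.lookup
  have "p * q = (\<Sum>v\<in>?K p. \<Sum>w\<in>?K q. Poly_Mapping.single (v + w) (?l p v * ?l q w))"
    by (subst (1) poly_mapping_sum_single[of p, symmetric], subst (1) poly_mapping_sum_single[of q, symmetric])
       (simp add: sum_product mult_single)
  then have "R_free (p * q) f g = (\<Sum>v\<in>?K p. \<Sum>w\<in>?K q. ?l p v * ?l q w * R_word v (R_word w f) g)"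
    by (simp add: R_free_sum R_free_single R_word_plus)
  also have "\<dots> = R_free p (R_free q f) g"
    unfolding R_free_def[of p] R_free_def[of q, abs_def]
    by (simp add: R_word_lincomb smooth_R_word assms sum_distrib_left mult.assoc)
  finally show ?thesis .
qed

lemma R_free_gen: "R_free (free_gen X) f g = R_gl X f g"
  by (simp add: free_gen_def R_free_single R_word_def)

lemma R_free_const: "R_free (free_const c) f g = c * f g"
  by (simp add: free_const_def R_free_single R_word_def zero_word_def)

lemma smooth_const: "smooth_GL4 (\<lambda>g. c)"
  by (simp add: smooth_on_def C_k_on_const)

lemma R_free_zero_fun:
  assumes "\<And>g. g \<in> GL4 \<Longrightarrow> f g = 0" "g \<in> GL4"
  shows "R_free p f g = 0"
proof -
  have "R_word w (\<lambda>g. \<Sum>i\<in>{}. 0 * 0) g = 0" for w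
    by (subst R_word_lincomb[where f = "\<lambda>_ _. 0"]) (auto simp: assms)
  then have "R_free p (\<lambda>g. 0) g = 0"
    by (simp add: R_free_def)
  then show ?thesis
    using R_free_cong[of "\<lambda>g. 0" f g p] assms smooth_const by auto
qed

theorem R_free_ug_rel:
  assumes "p \<in> ug_rel" "smooth_GL4 f" "g \<in> GL4"
  shows "R_free p f g = 0"
  using assms
proof (induction arbitrary: f g)
  case (add X Y)
  then show ?case by (simp add: R_free_diff R_free_gen R_gl_add)
next
  case (scale c X)
  then show ?case by (simp add: R_free_diff R_free_gen R_gl_scale R_free_mult R_free_const)
next
  case (bracket X Y)
  have e: "R_free (free_gen X) f = R_gl X f" for X by (rule ext) (rule R_free_gen)
  show ?case using bracket
    by (simp add: R_free_diff R_free_mult R_free_gen e R_gl_bracket)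
next
  case (sum p q)
  then show ?case by (simp add: R_free_add)
next
  case (lmult p r)
  then show ?case by (simp add: R_free_mult R_free_zero_fun)
next
  case (rmult p r)
  then show ?case by (simp add: R_free_mult smooth_R_free)
qed

section \<open>The universal enveloping algebra of gl(4,C)\<close>

lemma ug_rel_zero: "0 \<in> ug_rel"
  using ug_rel.lmult[OF ug_rel.add, of 0] by simp

lemma ug_rel_uminus: "p \<in> ug_rel \<Longrightarrow> - p \<in> ug_rel"
  using ug_rel.lmult[of p "- 1"] by simp

lemma ug_rel_diff: "p \<in> ug_rel \<Longrightarrow> q \<in> ug_rel \<Longrightarrow> p - q \<in> ug_rel"
  using ug_rel.sum[OF _ ug_rel_uminus, of p q] by simp

lemma one_notin_ug_rel: "1 \<notin> ug_rel"
proof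
  assume a: "1 \<in> ug_rel"
  have "mat 1 \<in> GL4" by (simp add: GL4_def invertible_def exI[of _ "mat 1"])
  then have "R_free (free_const 1) (\<lambda>_. 1) (mat 1) = 0"
    using R_free_ug_rel[OF a smooth_const] by (simp add: free_const_def)
  then show False by (simp add: R_free_const)
qed

quotient_type ug = gl4_free / "\<lambda>p q. p - q \<in> ug_rel"
proof (rule equivpI)
  show "reflp (\<lambda>p q. p - q \<in> ug_rel)" by (simp add: reflp_def ug_rel_zero)
  show "symp (\<lambda>p q. p - q \<in> ug_rel)"
    unfolding symp_def using ug_rel_uminus by (metis minus_diff_eq)
  show "transp (\<lambda>p q. p - q \<in> ug_rel)"
  proof (rule transpI)
    fix p q r :: gl4_free
    assume "p - q \<in> ug_rel" "q - r \<in> ug_rel"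
    from ug_rel.sum[OF this] show "p - r \<in> ug_rel" by simp
  qed
qed

instantiation ug :: ring_1
begin
lift_definition zero_ug :: ug is 0 .
lift_definition one_ug :: ug is 1 .
lift_definition plus_ug :: "ug \<Rightarrow> ug \<Rightarrow> ug" is "(+)"
proof -
  fix a b c d :: gl4_free
  assume "a - b \<in> ug_rel" "c - d \<in> ug_rel"
  from ug_rel.sum[OF this] show "a + c - (b + d) \<in> ug_rel" by (simp add: algebra_simps)
qed
lift_definition minus_ug :: "ug \<Rightarrow> ug \<Rightarrow> ug" is "(-)"
proof -
  fix a b c d :: gl4_free
  assume "a - b \<in> ug_rel" "c - d \<in> ug_rel"
  from ug_rel_diff[OF this] show "a - c - (b - d) \<in> ug_rel" by (simp add: algebra_simps)
qed
lift_definition uminus_ug :: "ug \<Rightarrow> ug" is uminus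
  using ug_rel_uminus by (metis minus_diff_minus)
lift_definition times_ug :: "ug \<Rightarrow> ug \<Rightarrow> ug" is "(*)"
proof -
  fix a b c d :: gl4_free
  assume "a - b \<in> ug_rel" "c - d \<in> ug_rel"
  from ug_rel.sum[OF ug_rel.rmult[OF this(1), of c] ug_rel.lmult[OF this(2), of b]]
  show "a * c - b * d \<in> ug_rel" by (simp add: algebra_simps)
qed
instance
proof
  fix a b c :: ug
  show "a + b + c = a + (b + c)" by transfer (simp add: add.assoc ug_rel_zero)
  show "a + b = b + a" by transfer (simp add: add.commute ug_rel_zero)
  show "0 + a = a" by transfer (simp add: ug_rel_zero)
  show "- a + a = 0" by transfer (simp add: ug_rel_zero)
  show "a - b = a + - b" by transfer (simp add: ug_rel_zero)
  show "a * b * c = a * (b * c)" by transfer (simp add: mult.assoc ug_rel_zero)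
  show "(a + b) * c = a * c + b * c" by transfer (simp add: distrib_right ug_rel_zero)
  show "a * (b + c) = a * b + a * c" by transfer (simp add: distrib_left ug_rel_zero)
  show "1 * a = a" by transfer (simp add: ug_rel_zero)
  show "a * 1 = a" by transfer (simp add: ug_rel_zero)
  show "(0::ug) \<noteq> 1" by transfer (use ug_rel_uminus one_notin_ug_rel in fastforce)
qed
end

definition ug_of :: "gl4 \<Rightarrow> ug" where
  "ug_of X = abs_ug (free_gen X)"

definition ug_const :: "complex \<Rightarrow> ug" where
  "ug_const c = abs_ug (free_const c)"

section \<open>The action of the enveloping algebra on smooth functions\<close>

definition Cinf_GL4 :: "(mat4 \<Rightarrow> complex) set" where
  "Cinf_GL4 = {f \<in> extensional GL4. smooth_on GL4 f}"

text \<open>Well-definedness on the quotient is available only for smooth functions; other arguments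
  get a dummy value.\<close>

lift_definition ug_act :: "ug \<Rightarrow> (mat4 \<Rightarrow> complex) \<Rightarrow> mat4 \<Rightarrow> complex" is
  "\<lambda>p f. if f \<in> Cinf_GL4 then restrict (R_free p f) GL4 else undefined"
proof -
  fix p q :: gl4_free
  assume pq: "p - q \<in> ug_rel"
  have "R_free p f g = R_free q f g" if "f \<in> Cinf_GL4" "g \<in> GL4" for f g
    using R_free_ug_rel[OF pq, of f g] that by (simp add: R_free_diff Cinf_GL4_def)
  then show "(\<lambda>f. if f \<in> Cinf_GL4 then restrict (R_free p f) GL4 else undefined) =
      (\<lambda>f. if f \<in> Cinf_GL4 then restrict (R_free q f) GL4 else undefined)"
    by (auto simp: fun_eq_iff restrict_def)
qed

lemma ug_act_in_Cinf: "f \<in> Cinf_GL4 \<Longrightarrow> ug_act u f \<in> Cinf_GL4"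
proof (transfer, simp)
  fix p f assume "f \<in> Cinf_GL4"
  then have "smooth_GL4 (R_free p f)" by (simp add: Cinf_GL4_def smooth_R_free)
  then show "restrict (R_free p f) GL4 \<in> Cinf_GL4"
    using smooth_cong[of "R_free p f" "restrict (R_free p f) GL4"] by (simp add: Cinf_GL4_def)
qed

lemma ug_act_of: "f \<in> Cinf_GL4 \<Longrightarrow> ug_act (ug_of X) f = restrict (R_gl X f) GL4"
  by (simp add: ug_of_def ug_act.abs_eq R_free_gen restrict_def fun_eq_iff)

lemma ug_act_const: "f \<in> Cinf_GL4 \<Longrightarrow> ug_act (ug_const c) f = (\<lambda>g\<in>GL4. c * f g)"
  by (simp add: ug_const_def ug_act.abs_eq R_free_const restrict_def fun_eq_iff)

lemma ug_act_add: "f \<in> Cinf_GL4 \<Longrightarrow> ug_act (u + v) f = (\<lambda>g\<in>GL4. ug_act u f g + ug_act v f g)"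
  by transfer (simp add: R_free_add restrict_def fun_eq_iff)

lemma ug_act_mult:
  assumes "f \<in> Cinf_GL4"
  shows "ug_act (u * v) f = ug_act u (ug_act v f)"
  using assms ug_act_in_Cinf[OF assms, of v]
proof (transfer, simp)
  fix p q f assume f: "f \<in> Cinf_GL4"
  then have s: "smooth_GL4 f" "smooth_GL4 (R_free q f)" by (simp_all add: Cinf_GL4_def smooth_R_free)
  show "restrict (R_free (p * q) f) GL4 = restrict (R_free p (restrict (R_free q f) GL4)) GL4"
  proof (rule restrict_ext)
    fix g assume g: "g \<in> GL4"
    show "R_free (p * q) f g = R_free p (restrict (R_free q f) GL4) g"
      unfolding R_free_mult[OF s(1) g] by (rule R_free_cong) (simp_all add: s g)
  qed
qed

section \<open>The spaces in the statement\<close>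

text \<open>Matrix indices are the numerals 1, 2, 3, 4 of the type \<open>4\<close>. In that type \<open>4 = 0\<close>, so its
  order is not the usual order of the indices; triangularity is therefore always spelled out.\<close>

definition mat_unit :: "4 \<Rightarrow> 4 \<Rightarrow> 'a::zero_neq_one^4^4" where
  "mat_unit i j = axis i (axis j 1)"

definition ug_E :: "ug^4^4" where
  "ug_E = (\<chi> i j. ug_of (mat_unit i j))"

text \<open>Scalars in a matrix over the enveloping algebra stand for scalar multiples of the identity.\<close>

definition I_ideal :: "nat \<Rightarrow> complex \<Rightarrow> complex \<Rightarrow> ug set" where
  "I_ideal k lam1 lam2 =
    {(\<Sum>i\<in>UNIV. \<Sum>j\<in>UNIV. P i j *
        ((ug_E - mat (ug_const lam1)) ** (ug_E - mat (ug_const (lam2 + of_nat k)))) $ i $ j)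
      + Q * ((\<Sum>i\<in>UNIV. ug_E $ i $ i) - ug_const (of_nat k * lam1 + (4 - of_nat k) * lam2))
     | (P :: 4 \<Rightarrow> 4 \<Rightarrow> ug) (Q :: ug). True}"

definition n_alg :: "mat4 set" where
  "n_alg = span {mat_unit 2 1, mat_unit 3 2, mat_unit 4 3, mat_unit 3 1, mat_unit 4 2, mat_unit 4 1}"

definition n_form :: "real \<Rightarrow> real \<Rightarrow> real \<Rightarrow> real \<Rightarrow> real \<Rightarrow> real \<Rightarrow> mat4 \<Rightarrow> real" where
  "n_form \<alpha> \<beta>1 \<beta>2 \<gamma>1 \<gamma>2 \<gamma>3 X = \<alpha> * X $ 4 $ 1 + \<beta>1 * X $ 3 $ 1 + \<beta>2 * X $ 4 $ 2
     + \<gamma>1 * X $ 2 $ 1 + \<gamma>2 * X $ 3 $ 2 + \<gamma>3 * X $ 4 $ 3"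

text \<open>\<^term>\<open>mexp\<close> is injective on the strictly lower triangular matrices, see \<open>chi_mexp\<close> below.\<close>

definition chi :: "(mat4 \<Rightarrow> real) \<Rightarrow> mat4 \<Rightarrow> complex" where
  "chi l s = exp (2 * of_real pi * \<i> * of_real (l (the_inv_into n_alg mexp s)))"

lemma n_alg_nth:
  assumes "X \<in> n_alg"
  shows "X $ 1 $ 1 = 0" "X $ 1 $ 2 = 0" "X $ 1 $ 3 = 0" "X $ 1 $ 4 = 0"
    "X $ 2 $ 2 = 0" "X $ 2 $ 3 = 0" "X $ 2 $ 4 = 0" "X $ 3 $ 3 = 0" "X $ 3 $ 4 = 0" "X $ 4 $ 4 = 0"
  using assms unfolding n_alg_def
  by (induction rule: span_induct_alt) (auto simp: mat_unit_def axis_def)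

lemma mexp_n_alg:
  assumes "X \<in> n_alg"
  shows "mexp X = mat 1 + X + (X ** X) /\<^sub>R 2 + (X ** (X ** X)) /\<^sub>R 6"
proof -
  have 4: "X ** (X ** (X ** X)) = 0"
    by (simp add: vec_eq_iff forall_4 matrix_matrix_mult_def sum_4 n_alg_nth[OF assms])
  have "(((**) X) ^^ (n + 4)) (mat 1) = 0" for n
    by (induction n) (simp_all add: numeral_eq_Suc 4)
  then have "(((**) X) ^^ n) (mat 1) = 0" if "n \<notin> {..<4}" for n
    using that by (metis lessThan_iff not_less le_add_diff_inverse2)
  then have "mexp X = (\<Sum>n<4. ((((**) X) ^^ n) (mat 1)) /\<^sub>R fact n)"
    unfolding mexp_def by (intro suminf_finite) auto
  then show ?thesis
    by (simp add: eval_nat_numeral fact_numeral)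
qed

lemma inj_on_mexp_n_alg: "inj_on mexp n_alg"
proof (rule inj_onI)
  fix X Y assume X: "X \<in> n_alg" and Y: "Y \<in> n_alg" and eq: "mexp X = mexp Y"
  have e: "mexp X $ i $ j = mexp Y $ i $ j" for i j using eq by simp
  have 1: "X $ 2 $ 1 = Y $ 2 $ 1" "X $ 3 $ 2 = Y $ 3 $ 2" "X $ 4 $ 3 = Y $ 4 $ 3"
    using e[of 2 1] e[of 3 2] e[of 4 3]
    by (simp_all add: mexp_n_alg X Y matrix_matrix_mult_def sum_4 n_alg_nth[OF X] n_alg_nth[OF Y] mat_def)
  then have 2: "X $ 3 $ 1 = Y $ 3 $ 1" "X $ 4 $ 2 = Y $ 4 $ 2"
    using e[of 3 1] e[of 4 2]
    by (simp_all add: mexp_n_alg X Y matrix_matrix_mult_def sum_4 n_alg_nth[OF X] n_alg_nth[OF Y] mat_def)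
  with 1 have "X $ 4 $ 1 = Y $ 4 $ 1"
    using e[of 4 1]
    by (simp add: mexp_n_alg X Y matrix_matrix_mult_def sum_4 n_alg_nth[OF X] n_alg_nth[OF Y] mat_def)
  with 1 2 show "X = Y"
    by (simp add: vec_eq_iff forall_4 n_alg_nth[OF X] n_alg_nth[OF Y])
qed

lemma chi_mexp: "X \<in> n_alg \<Longrightarrow> chi l (mexp X) = exp (2 * of_real pi * \<i> * of_real (l X))"
  by (simp add: chi_def the_inv_into_f_f inj_on_mexp_n_alg)

definition S_II :: "mat4 set" where
  "S_II = mexp ` span {mat_unit 2 1, mat_unit 4 3, mat_unit 3 1, mat_unit 4 2, mat_unit 4 1}"

definition Cinf_chi :: "mat4 set \<Rightarrow> (mat4 \<Rightarrow> complex) \<Rightarrow> ug set \<Rightarrow> (mat4 \<Rightarrow> complex) set" where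
  "Cinf_chi S \<psi> I = {f \<in> Cinf_GL4.
     (\<forall>s\<in>S. \<forall>g\<in>GL4. \<forall>k. orthogonal_matrix k \<longrightarrow> f (s ** g ** k) = \<psi> s * f g) \<and>
     (\<forall>u\<in>I. ug_act u f = (\<lambda>g\<in>GL4. 0))}"

definition NA_coords :: "(real \<times> (real^4)) set" where
  "NA_coords = UNIV \<times> {a. \<forall>i. 0 < a $ i}"

definition Xi_II :: "(mat4 \<Rightarrow> complex) \<Rightarrow> real \<times> (real^4) \<Rightarrow> complex" where
  "Xi_II f = (\<lambda>(u, a)\<in>NA_coords. f (mexp (u *\<^sub>R mat_unit 3 2) ** (\<chi> i j. if i = j then a $ i else 0)))"

definition Cinf_chi_NA :: "(mat4 \<Rightarrow> complex) \<Rightarrow> ug set \<Rightarrow> (real \<times> (real^4) \<Rightarrow> complex) set" where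
  "Cinf_chi_NA \<psi> I = Xi_II ` Cinf_chi S_II \<psi> I"

end

theory Submission
  imports Defs
begin

text \<open>
  A single generator of the ideal, the \<open>(4,1)\<close> entry of
  \<open>(E - \<lambda>\<^sub>1)(E - \<lambda>\<^sub>2 - k)\<close>, already forces \<open>f\<close> to vanish on the points \<open>g = exp(u E\<^sub>3\<^sub>2) a\<close>.
  It says
  \<open>E\<^sub>4\<^sub>1 E\<^sub>1\<^sub>1 f + E\<^sub>4\<^sub>2 E\<^sub>2\<^sub>1 f + E\<^sub>4\<^sub>3 E\<^sub>3\<^sub>1 f + E\<^sub>4\<^sub>4 E\<^sub>4\<^sub>1 f = (\<lambda>\<^sub>1 + \<lambda>\<^sub>2 + k) E\<^sub>4\<^sub>1 f\<close>.

  For a function \<open>h\<close> that transforms on the left under \<open>S = S_II\<close> by \<open>\<chi>\<^sub>l\<close>, the derivative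
  \<open>R\<^sub>X h(g)\<close> is a multiple of \<open>h(g)\<close> whenever \<open>g X g\<^sup>-\<^sup>1\<close> lies in the Lie algebra of \<open>S\<close>, the
  factor being \<open>2 \<pi> i l(g X g\<^sup>-\<^sup>1)\<close> (lemma \<open>R_real_left_equivariant\<close>). All right derivatives of
  \<open>f\<close> are again of this kind (lemma \<open>left_equivariant_R_real\<close>), so the rule may be iterated. At
  the point \<open>g\<close> above, \<open>E\<^sub>3\<^sub>1\<close> and \<open>E\<^sub>4\<^sub>1\<close> are conjugated to multiples of themselves, on which \<open>l\<close> vanishes;
  \<open>E\<^sub>2\<^sub>1\<close> goes to \<open>(a\<^sub>2/a\<^sub>1)(E\<^sub>2\<^sub>1 + u E\<^sub>3\<^sub>1)\<close> and \<open>E\<^sub>4\<^sub>2\<close> to \<open>(a\<^sub>4/a\<^sub>2) E\<^sub>4\<^sub>2\<close>, on which \<open>l\<close> takes the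
  values \<open>a\<^sub>2/a\<^sub>1\<close> and \<open>a\<^sub>4/a\<^sub>2\<close>. The image of \<open>E\<^sub>4\<^sub>3\<close> also lies in the Lie algebra, so \<open>E\<^sub>4\<^sub>3\<close>
  sends the equivariant function \<open>E\<^sub>3\<^sub>1 f\<close>, which vanishes at \<open>g\<close>, to one that vanishes there; and
  \<open>E\<^sub>4\<^sub>4 E\<^sub>4\<^sub>1 = E\<^sub>4\<^sub>1 E\<^sub>4\<^sub>4 + E\<^sub>4\<^sub>1\<close>. Every term of the relation except \<open>E\<^sub>4\<^sub>2 E\<^sub>2\<^sub>1 f\<close> therefore
  vanishes at \<open>g\<close>, and what remains is \<open>(2 \<pi> i)\<^sup>2 (a\<^sub>4/a\<^sub>1) f(g) = 0\<close>.

  Conversely the zero function belongs to the space. As functions on the group are extensional,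
  this uses that \<open>S\<close> and the orthogonal group consist of invertible matrices.
\<close>

section \<open>The group elements involved\<close>

abbreviation s_II :: "mat4 set" where
  "s_II \<equiv> span {mat_unit 2 1, mat_unit 4 3, mat_unit 3 1, mat_unit 4 2, mat_unit 4 1}"

abbreviation na_point :: "real \<Rightarrow> real^4 \<Rightarrow> mat4" where
  "na_point u a \<equiv> mexp (u *\<^sub>R mat_unit 3 2) ** (\<chi> i j. if i = j then a $ i else 0)"

lemma s_II_subset_n_alg: "s_II \<subseteq> n_alg"
  unfolding n_alg_def by (rule span_mono) auto

lemma mexp_n_alg_in_GL4:
  assumes "X \<in> n_alg"
  shows "mexp X \<in> GL4"
proof -
  have "x = 0" if "mexp X *v x = 0" for x
  proof -
    have c: "(mexp X *v x) $ i = 0" for i using that by simp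
    note nth = mexp_n_alg[OF assms] matrix_vector_mult_def matrix_matrix_mult_def sum_4
      n_alg_nth[OF assms] mat_def
    \<comment> \<open>forward substitution in a lower triangular system\<close>
    have 1: "x $ 1 = 0" using c[of 1] by (simp add: nth)
    have 2: "x $ 2 = 0" using c[of 2] by (simp add: nth 1)
    have 3: "x $ 3 = 0" using c[of 3] by (simp add: nth 1 2)
    have "x $ 4 = 0" using c[of 4] by (simp add: nth 1 2 3)
    with 1 2 3 show "x = 0" by (simp add: vec_eq_iff forall_4)
  qed
  then show ?thesis
    by (auto simp: GL4_def invertible_left_inverse matrix_left_invertible_ker)
qed

lemma GL4_mult: "g \<in> GL4 \<Longrightarrow> h \<in> GL4 \<Longrightarrow> g ** h \<in> GL4"
  by (simp add: GL4_def invertible_mult)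

lemma S_II_subset_GL4: "S_II \<subseteq> GL4"
  using s_II_subset_n_alg mexp_n_alg_in_GL4 by (auto simp: S_II_def)

lemma orthogonal_matrix_in_GL4: "orthogonal_matrix k \<Longrightarrow> k \<in> GL4" for k :: mat4
  by (auto simp: GL4_def invertible_def orthogonal_matrix_def)

lemma na_point_nth:
  "na_point u a $ i $ j = (if i = j then a $ i else if i = 3 \<and> j = 2 then u * a $ 2 else 0)"
proof -
  have X: "u *\<^sub>R mat_unit 3 2 \<in> n_alg"
    unfolding n_alg_def by (intro span_scale span_base) simp
  have N: "mexp (u *\<^sub>R mat_unit 3 2) = mat 1 + u *\<^sub>R mat_unit 3 2"
    unfolding mexp_n_alg[OF X]
    by (simp add: vec_eq_iff forall_4 matrix_matrix_mult_def sum_4 mat_unit_def axis_def)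
  have "\<forall>i j. na_point u a $ i $ j = (if i = j then a $ i else if i = 3 \<and> j = 2 then u * a $ 2 else 0)"
    unfolding N by (simp add: forall_4 matrix_matrix_mult_def sum_4 mat_def mat_unit_def axis_def)
  then show ?thesis by blast
qed

lemma na_point_in_GL4:
  assumes "\<forall>i. 0 < a $ i"
  shows "na_point u a \<in> GL4"
proof (rule GL4_mult)
  show "mexp (u *\<^sub>R mat_unit 3 2) \<in> GL4"
    by (intro mexp_n_alg_in_GL4) (simp add: n_alg_def span_scale span_base)
  have "(\<chi> i j. if i = j then a $ i else 0) ** (\<chi> i j. if i = j then 1 / a $ i else 0) = (mat 1 :: mat4)"
    using less_imp_neq[OF assms[rule_format], symmetric]
    by (simp add: vec_eq_iff matrix_matrix_mult_def mat_def forall_4 sum_4)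
  then show "(\<chi> i j. if i = j then a $ i else 0) \<in> GL4"
    unfolding GL4_def mem_Collect_eq invertible_right_inverse by (rule exI)
qed

section \<open>Differentiation of left equivariant functions\<close>

definition left_equivariant :: "mat4 set \<Rightarrow> (mat4 \<Rightarrow> complex) \<Rightarrow> (mat4 \<Rightarrow> complex) \<Rightarrow> bool" where
  "left_equivariant S \<psi> f \<longleftrightarrow> (\<forall>s\<in>S. \<forall>g\<in>GL4. f (s ** g) = \<psi> s * f g)"

text \<open>Right derivatives commute with left translations.\<close>

lemma left_equivariant_R_real:
  assumes f: "smooth_GL4 f" and eq: "left_equivariant S \<psi> f" and S: "S \<subseteq> GL4"
  shows "left_equivariant S \<psi> (R_real X f)"
  unfolding left_equivariant_def
proof (intro ballI)
  fix s g assume s: "s \<in> S" and g: "g \<in> GL4"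
  have sg: "s ** g \<in> GL4" using s g S GL4_mult by auto
  have 1: "((\<lambda>h. f (s ** h)) has_derivative (\<lambda>v. deriv_at f (s ** g) (s ** v))) (at g)"
    by (rule has_derivative_compose[where g = f, OF bounded_linear_imp_has_derivative
          [OF bounded_linear_matrix_mult_left] smooth_on_has_derivative[OF f sg]])
  have "((\<lambda>h. \<psi> s * f h) has_derivative (\<lambda>v. \<psi> s * deriv_at f g v)) (at g)"
    by (intro has_derivative_mult_right smooth_on_has_derivative[OF f g])
  then have 2: "((\<lambda>h. f (s ** h)) has_derivative (\<lambda>v. \<psi> s * deriv_at f g v)) (at g)"
    by (rule has_derivative_transform_within_open[OF _ open_GL4 g])
       (use eq s in \<open>simp add: left_equivariant_def\<close>)
  have "deriv_at f (s ** g) (s ** v) = \<psi> s * deriv_at f g v" for v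
    using has_derivative_unique[OF 1 2] by meson
  then show "R_real X f (s ** g) = \<psi> s * R_real X f g"
    by (simp add: R_real_eq f g sg flip: matrix_mul_assoc)
qed

text \<open>Since \<open>g exp(tX) = exp(tY) g\<close> for \<open>Y = g X g\<^sup>-\<^sup>1\<close>, the right derivative along \<open>X\<close> is a left
  derivative along \<open>Y\<close>, which acts by the differential of the character. Both sides are the
  derivative of \<open>f\<close> along the tangent vector \<open>gX = Yg\<close>, so comparing tangent vectors
  suffices.\<close>

lemma R_real_left_equivariant:
  assumes f: "smooth_GL4 f" and eq: "left_equivariant S_II (chi l) f" and g: "g \<in> GL4"
    and l: "linear l" and Y: "Y \<in> s_II" and gX: "g ** X = Y ** g"
  shows "R_real X f g = 2 * of_real pi * \<i> * of_real (l Y) * f g"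
proof -
  have "((\<lambda>t. mexp (t *\<^sub>R Y) ** g) has_derivative (\<lambda>t. (t *\<^sub>R Y) ** g)) (at 0)"
    using bounded_linear.has_derivative[OF bounded_linear_matrix_mult_right
      mexp_has_vector_derivative[unfolded has_vector_derivative_def]] .
  moreover have "(f has_derivative deriv_at f g) (at (mexp (0 *\<^sub>R Y) ** g))"
    using smooth_on_has_derivative[OF f g] by simp
  ultimately have "((\<lambda>t. f (mexp (t *\<^sub>R Y) ** g)) has_derivative (\<lambda>t. deriv_at f g ((t *\<^sub>R Y) ** g))) (at 0)"
    by (rule has_derivative_compose)
  moreover have "deriv_at f g ((t *\<^sub>R Y) ** g) = t *\<^sub>R deriv_at f g (Y ** g)" for t
    using linear_cmul[OF linear_D[OF f g]]
      linear_cmul[OF linear_conv_bounded_linear[THEN iffD2, OF bounded_linear_matrix_mult_right[of g]]]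
    by simp
  ultimately have 1: "((\<lambda>t. f (mexp (t *\<^sub>R Y) ** g)) has_vector_derivative R_real X f g) (at 0)"
    by (simp add: has_vector_derivative_def R_real_eq f g gX)
  have tY: "t *\<^sub>R Y \<in> s_II" for t using Y by (rule span_scale)
  have "f (mexp (t *\<^sub>R Y) ** g) = exp (t *\<^sub>R (2 * of_real pi * \<i> * of_real (l Y))) * f g" for t
    using eq tY[of t] g s_II_subset_n_alg linear_cmul[OF l]
    by (auto simp: left_equivariant_def S_II_def chi_mexp subset_iff scaleR_conv_of_real[of _ "_ :: complex"] mult_ac)
  moreover have "((\<lambda>t. exp (t *\<^sub>R (2 * of_real pi * \<i> * of_real (l Y))) * f g) has_vector_derivative
      2 * of_real pi * \<i> * of_real (l Y) * f g) (at 0)"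
    using has_vector_derivative_mult_left[OF exp_scaleR_has_vector_derivative_right
        [of "2 * of_real pi * \<i> * of_real (l Y)" 0 UNIV], of "f g"] by simp
  ultimately have "((\<lambda>t. f (mexp (t *\<^sub>R Y) ** g)) has_vector_derivative
      2 * of_real pi * \<i> * of_real (l Y) * f g) (at 0)"
    by presburger
  from vector_derivative_unique_at[OF 1 this] show ?thesis .
qed

section \<open>The enveloping algebra\<close>

lemma R_gl_mat_unit: "R_gl (mat_unit i j) f g = R_real (mat_unit i j) f g"
proof -
  have "map_matrix Re (mat_unit i j) = mat_unit i j" "map_matrix Im (mat_unit i j) = 0"
    by (simp_all add: vec_eq_iff map_matrix_def mat_unit_def axis_def)
  then show ?thesis by (simp add: R_gl_def R_real_def)
qed

lemma ug_act_diff: "f \<in> Cinf_GL4 \<Longrightarrow> ug_act (u - v) f = (\<lambda>g\<in>GL4. ug_act u f g - ug_act v f g)"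
  by transfer (simp add: R_free_diff restrict_def fun_eq_iff)

lemma ug_act_E_E:
  assumes f: "f \<in> Cinf_GL4" and g: "g \<in> GL4"
  shows "ug_act (ug_of (mat_unit i j) * ug_of (mat_unit r s)) f g
    = R_real (mat_unit i j) (R_real (mat_unit r s) f) g"
proof -
  have s: "smooth_GL4 (R_real (mat_unit r s) f)"
    using f by (simp add: Cinf_GL4_def smooth_R_real)
  have e: "ug_act (ug_of (mat_unit r s)) f = restrict (R_real (mat_unit r s) f) GL4"
    by (simp add: ug_act_of f R_gl_mat_unit restrict_def fun_eq_iff)
  have c: "restrict (R_real (mat_unit r s) f) GL4 \<in> Cinf_GL4"
    using ug_act_in_Cinf[OF f, of "ug_of (mat_unit r s)"] by (simp add: e)
  show ?thesis
    using R_real_cong[OF _ s g, of "restrict (R_real (mat_unit r s) f) GL4"]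
    by (simp add: ug_act_mult f e ug_act_of c g R_gl_mat_unit)
qed

lemma ug_act_E_const:
  assumes f: "f \<in> Cinf_GL4" and g: "g \<in> GL4"
  shows "ug_act (ug_of (mat_unit i j) * ug_const c) f g = c * R_real (mat_unit i j) f g"
    "ug_act (ug_const c * ug_of (mat_unit i j)) f g = c * R_real (mat_unit i j) f g"
proof -
  have s: "smooth_GL4 f" using f by (simp add: Cinf_GL4_def)
  have c: "(\<lambda>g\<in>GL4. c * f g) \<in> Cinf_GL4"
    using ug_act_in_Cinf[OF f, of "ug_const c"] by (simp add: ug_act_const f)
  have "R_real (mat_unit i j) (\<lambda>g\<in>GL4. c * f g) g = R_real (mat_unit i j) (\<lambda>g. \<Sum>_\<in>{()}. c * f g) g"
    by (rule R_real_cong) (use c in \<open>auto simp: g Cinf_GL4_def\<close>)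
  also have "\<dots> = c * R_real (mat_unit i j) f g"
    by (subst R_real_lincomb) (auto simp: s g)
  finally show "ug_act (ug_of (mat_unit i j) * ug_const c) f g = c * R_real (mat_unit i j) f g"
    by (simp add: ug_act_mult f ug_act_const ug_act_of c g R_gl_mat_unit)
  show "ug_act (ug_const c * ug_of (mat_unit i j)) f g = c * R_real (mat_unit i j) f g"
    using ug_act_in_Cinf[OF f, of "ug_of (mat_unit i j)"]
    by (simp add: ug_act_mult f ug_act_const ug_act_of g R_gl_mat_unit)
qed

lemma sum_matrix_unit_mult:
  fixes A :: "'a::ring_1^'n^'m"
  shows "(\<Sum>i\<in>UNIV. \<Sum>j\<in>UNIV. (if i = r \<and> j = s then 1 else 0) * A $ i $ j) = A $ r $ s"
proof -
  have "(\<Sum>j\<in>UNIV. (if i = r \<and> j = s then 1 else 0) * A $ i $ j) = (if i = r then A $ i $ s else 0)" for i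
    by (cases "i = r") (simp_all add: if_distrib[of "\<lambda>x. x * _"] cong: if_cong)
  then show ?thesis by simp
qed

lemma I_ideal_entry:
  "((ug_E - mat (ug_const lam1)) ** (ug_E - mat (ug_const (lam2 + of_nat k)))) $ i $ j
     \<in> I_ideal k lam1 lam2"
  unfolding I_ideal_def mem_Collect_eq
  by (rule exI[of _ "\<lambda>i' j'. if i' = i \<and> j' = j then 1 else 0"], rule exI[of _ 0])
    (simp only: sum_matrix_unit_mult mult_zero_left add_0_right simp_thms)

lemma ug_E_quadratic_41:
  "((ug_E - mat (ug_const p)) ** (ug_E - mat (ug_const q))) $ 4 $ 1
    = ug_of (mat_unit 4 1) * ug_of (mat_unit 1 1) + ug_of (mat_unit 4 2) * ug_of (mat_unit 2 1)
    + ug_of (mat_unit 4 3) * ug_of (mat_unit 3 1) + ug_of (mat_unit 4 4) * ug_of (mat_unit 4 1)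
    - ug_of (mat_unit 4 1) * ug_const q - ug_const p * ug_of (mat_unit 4 1)"
  by (simp add: matrix_matrix_mult_def sum_4 ug_E_def mat_def algebra_simps)

text \<open>The two scalar terms of the \<open>(4,1)\<close> entry combine because constants commute with the
  action; the constant term \<open>\<lambda>\<^sub>1 (\<lambda>\<^sub>2 + k)\<close> occurs only on the diagonal.\<close>

lemma quadratic_relation_41:
  assumes f: "f \<in> Cinf_GL4" and g: "g \<in> GL4"
    and I: "\<forall>u\<in>I_ideal k lam1 lam2. ug_act u f = (\<lambda>g\<in>GL4. 0)"
  shows "R_real (mat_unit 4 1) (R_real (mat_unit 1 1) f) g + R_real (mat_unit 4 2) (R_real (mat_unit 2 1) f) g
    + R_real (mat_unit 4 3) (R_real (mat_unit 3 1) f) g + R_real (mat_unit 4 4) (R_real (mat_unit 4 1) f) g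
    = (lam1 + lam2 + of_nat k) * R_real (mat_unit 4 1) f g"
proof -
  have "ug_act (((ug_E - mat (ug_const lam1)) ** (ug_E - mat (ug_const (lam2 + of_nat k)))) $ 4 $ 1) f g = 0"
    using I I_ideal_entry g by (metis restrict_apply')
  then show ?thesis
    unfolding ug_E_quadratic_41
    by (simp add: ug_act_diff ug_act_add ug_act_E_E ug_act_E_const f g algebra_simps)
qed

section \<open>Vanishing on representatives of the quotient\<close>

lemma linear_n_form: "linear (n_form \<alpha> \<beta>1 \<beta>2 \<gamma>1 \<gamma>2 \<gamma>3)"
  by (rule linearI) (simp_all add: n_form_def algebra_simps)

lemma vanishing_at_na_point:
  assumes f: "f \<in> Cinf_chi S_II (chi (n_form 0 0 1 1 0 0)) (I_ideal k lam1 lam2)"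
    and a: "\<forall>i. 0 < a $ i"
  shows "f (na_point u a) = 0"
proof -
  define g where "g = na_point u a"
  have g: "g \<in> GL4" unfolding g_def by (rule na_point_in_GL4[OF a])
  have g_nth: "g $ i $ j = (if i = j then a $ i else if i = 3 \<and> j = 2 then u * a $ 2 else 0)" for i j
    unfolding g_def by (rule na_point_nth)
  have a0: "a $ i \<noteq> 0" for i using a by (metis less_irrefl)
  have fC: "f \<in> Cinf_GL4" and fI: "\<forall>u\<in>I_ideal k lam1 lam2. ug_act u f = (\<lambda>g\<in>GL4. 0)"
    using f by (auto simp: Cinf_chi_def)
  have fs: "smooth_GL4 f" using fC by (simp add: Cinf_GL4_def)
  let ?l = "n_form 0 0 1 1 0 0"
  have feq: "left_equivariant S_II (chi ?l) f"
    unfolding left_equivariant_def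
  proof (intro ballI)
    fix s g assume "s \<in> S_II" "g \<in> GL4"
    moreover have "orthogonal_matrix (mat 1 :: mat4)" by (rule orthogonal_matrix_id)
    ultimately have "f (s ** g ** mat 1) = chi ?l s * f g"
      using f unfolding Cinf_chi_def by blast
    then show "f (s ** g) = chi ?l s * f g" by simp
  qed
  \<comment> \<open>In each use of this rule below, the witness \<open>Y\<close> is \<open>g E\<^sub>i\<^sub>j g\<^sup>-\<^sup>1\<close>.\<close>
  have shift: "R_real (mat_unit i j) h g = 2 * of_real pi * \<i> * of_real (?l Y) * h g"
    if "smooth_GL4 h" "left_equivariant S_II (chi ?l) h" "Y \<in> s_II" "g ** mat_unit i j = Y ** g"
    for h i j Y
    by (rule R_real_left_equivariant[OF that(1,2) g linear_n_form that(3,4)])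
  note R_smooth = smooth_R_real[OF fs] and R_eq = left_equivariant_R_real[OF fs feq S_II_subset_GL4]
  note ad = vec_eq_iff forall_4 matrix_matrix_mult_def sum_4 mat_unit_def axis_def g_nth a0
  note sp = span_add span_scale span_base
  have E41: "R_real (mat_unit 4 1) h g = 0"
    if "smooth_GL4 h" "left_equivariant S_II (chi ?l) h" for h
  proof -
    have "R_real (mat_unit 4 1) h g = 2 * of_real pi * \<i> * of_real (?l ((a$4 / a$1) *\<^sub>R mat_unit 4 1)) * h g"
      by (rule shift[OF that]) (intro sp, simp, simp add: ad)
    then show ?thesis by (simp add: n_form_def mat_unit_def axis_def)
  qed
  have E31: "R_real (mat_unit 3 1) f g = 0"
  proof -
    have "R_real (mat_unit 3 1) f g = 2 * of_real pi * \<i> * of_real (?l ((a$3 / a$1) *\<^sub>R mat_unit 3 1)) * f g"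
      by (rule shift[OF fs feq]) (intro sp, simp, simp add: ad)
    then show ?thesis by (simp add: n_form_def mat_unit_def axis_def)
  qed
  have E21: "R_real (mat_unit 2 1) f g = 2 * of_real pi * \<i> * of_real (a$2 / a$1) * f g"
  proof -
    have "R_real (mat_unit 2 1) f g = 2 * of_real pi * \<i>
        * of_real (?l ((a$2 / a$1) *\<^sub>R mat_unit 2 1 + (u * a$2 / a$1) *\<^sub>R mat_unit 3 1)) * f g"
      by (rule shift[OF fs feq]) (intro sp, simp, simp, simp add: ad)
    then show ?thesis by (simp add: n_form_def mat_unit_def axis_def)
  qed
  have E42: "R_real (mat_unit 4 2) (R_real (mat_unit 2 1) f) g
      = 2 * of_real pi * \<i> * of_real (a$4 / a$2) * R_real (mat_unit 2 1) f g"
  proof -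
    have "R_real (mat_unit 4 2) (R_real (mat_unit 2 1) f) g
      = 2 * of_real pi * \<i> * of_real (?l ((a$4 / a$2) *\<^sub>R mat_unit 4 2)) * R_real (mat_unit 2 1) f g"
      by (rule shift[OF R_smooth R_eq]) (intro sp, simp, simp add: ad)
    then show ?thesis by (simp add: n_form_def mat_unit_def axis_def)
  qed
  have E43: "R_real (mat_unit 4 3) (R_real (mat_unit 3 1) f) g = 0"
  proof -
    have "R_real (mat_unit 4 3) (R_real (mat_unit 3 1) f) g = 2 * of_real pi * \<i>
        * of_real (?l ((a$4 / a$3) *\<^sub>R mat_unit 4 3 + (- u * a$4 / a$3) *\<^sub>R mat_unit 4 2))
        * R_real (mat_unit 3 1) f g"
      by (rule shift[OF R_smooth R_eq]) (intro sp, simp, simp, simp add: ad)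
    then show ?thesis by (simp add: E31)
  qed
  have br: "mat_unit 4 4 ** mat_unit 4 1 - mat_unit 4 1 ** mat_unit 4 4 = (mat_unit 4 1 :: mat4)"
    by (simp add: vec_eq_iff forall_4 matrix_matrix_mult_def sum_4 mat_unit_def axis_def)
  \<comment> \<open>\<open>g E\<^sub>4\<^sub>4 g\<^sup>-\<^sup>1\<close> is outside the Lie algebra of \<open>S_II\<close>, so \<open>E\<^sub>4\<^sub>4 E\<^sub>4\<^sub>1\<close> is replaced by
    \<open>E\<^sub>4\<^sub>1 E\<^sub>4\<^sub>4 + E\<^sub>4\<^sub>1\<close>.\<close>
  have E44: "R_real (mat_unit 4 4) (R_real (mat_unit 4 1) f) g = 0"
    using R_real_bracket[OF fs g, of "mat_unit 4 4" "mat_unit 4 1"]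
    by (simp add: br E41[OF fs feq] E41[OF R_smooth R_eq])
  have "R_real (mat_unit 4 2) (R_real (mat_unit 2 1) f) g = 0"
    using quadratic_relation_41[OF fC g fI]
    by (simp add: E41[OF fs feq] E41[OF R_smooth R_eq] E43 E44)
  then have "f g = 0" by (simp add: E42 E21 a0)
  then show ?thesis by (simp add: g_def)
qed

lemma zero_in_Cinf_chi:
  assumes S: "S \<subseteq> GL4"
  shows "(\<lambda>g\<in>GL4. 0) \<in> Cinf_chi S \<psi> I"
proof -
  have C: "(\<lambda>g\<in>GL4. 0) \<in> Cinf_GL4"
    using smooth_cong[of "\<lambda>g. 0 :: complex" "\<lambda>g\<in>GL4. 0"] smooth_const[of "0 :: complex"] by (simp add: Cinf_GL4_def)
  have "s ** g ** k \<in> GL4" if "s \<in> S" "g \<in> GL4" "orthogonal_matrix k" for s g k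
    using that S by (auto intro!: GL4_mult intro: orthogonal_matrix_in_GL4)
  moreover have "ug_act u (\<lambda>g\<in>GL4. 0) = (\<lambda>g\<in>GL4. 0)" for u
    using C by transfer (auto simp: restrict_def fun_eq_iff intro!: R_free_zero_fun)
  ultimately show ?thesis using C by (simp add: Cinf_chi_def)
qed

theorem theorem4p27:
  fixes lam1 lam2 :: complex and k :: nat
  assumes "lam1 - lam2 \<notin> \<int>" and "k \<in> {1, 2}"
  shows "Cinf_chi_NA (chi (n_form 0 0 1 1 0 0)) (I_ideal k lam1 lam2) = {\<lambda>p\<in>NA_coords. 0}"
proof -
  let ?V = "Cinf_chi S_II (chi (n_form 0 0 1 1 0 0)) (I_ideal k lam1 lam2)"
  have "Xi_II f = (\<lambda>p\<in>NA_coords. 0)" if "f \<in> ?V" for f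
    using vanishing_at_na_point[OF that]
    by (auto simp: Xi_II_def NA_coords_def restrict_def fun_eq_iff)
  moreover have "?V \<noteq> {}"
    using zero_in_Cinf_chi[OF S_II_subset_GL4] by blast
  ultimately show ?thesis
    unfolding Cinf_chi_NA_def by auto
qed

end
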